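(* Let $\alpha,\beta$ be real numbers with $0<\alpha\le 1$ and $\alpha+\beta>1$. Put $$r=\frac{\alpha+\beta-1}{\beta},\qquad 0<r\le 1,$$ and $$K(z)=\sum_{k=1}^\infty \frac{1}{k^{\alpha}\,(z+k^{\beta})}.$$ Then for any $n\in\mathbb{N}$ there exist two zeros $z_n^+$, $z_n^-$, with $z_n^-=\overline{z_n^+}$, of the function $$z\mapsto \frac{z^2}{n^2}+1-K(z),$$ such that: (i) if $r<1$, then $$z_n^+ = in+c_r\,e^{-i(r+1)\pi/2}\, n^{1-r}+O(1)+O(n^{1-2r}),\qquad c_r=\frac{\pi}{\beta\sin \pi r};$$ (ii) if $r=1$, then $$z_n^\pm=\pm in-\frac{1}{2\beta}\log n+O(1).$$
   Context: The function $K$ is the Laplace transform of the kernel $k(t)=\sum_{k=1}^\infty a_k e^{-b_k t}$ with $a_k=1/k^{\alpha}$, $b_k=k^\beta$. The conditions on $\alpha,\beta$ come from the assumptions $\sum_{k} a_k=\infty$ and $\sum_{k} a_k/b_k<\infty$. The set of all zeros of the functions $z^2+n^2-n^2K(z)$, $n=1,2,\dots$, is called the spectrum of the integro-differential equation $\theta_{tt}=\theta_{xx}-\int_0^t k(t-s)\,\theta_{xx}(x,s)\,ds$, $x\in(0,\pi)$, $t>0$, with Dirichlet boundary conditions. The zeros of interest are those with $|\Im z_n|\gg 1$.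
   Formalization: The constant in (i) is corrected to c_r = π/(2β sin πr), since the printed π/(β sin πr) is too large by a factor 2 for every r<1; the two conjugate zeros are claimed distinct only for all large n, since for small n they can be forced to be real and equal. *)

theory Defs
  imports "HOL-Analysis.Analysis" "HOL-Library.Landau_Symbols"
begin

definition kernel_poles :: "real \<Rightarrow> complex set" where
  "kernel_poles \<beta> = {- complex_of_real (real k powr \<beta>) |k::nat. k \<ge> 1}"

(* For \<alpha> + \<beta> > 1 and \<beta> > 0 the series converges absolutely at every point outside kernel_poles \<beta>.
   At a pole one summand is 1 / 0 = 0, so the value there is meaningless. *)
definition kernel_transform :: "real \<Rightarrow> real \<Rightarrow> complex \<Rightarrow> complex" where
  "kernel_transform \<alpha> \<beta> z =
     (\<Sum>j. let k = real (Suc j) in 1 / (complex_of_real (k powr \<alpha>) * (z + complex_of_real (k powr \<beta>))))"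

definition spectral_zeros :: "real \<Rightarrow> real \<Rightarrow> nat \<Rightarrow> complex set" where
  "spectral_zeros \<alpha> \<beta> n =
     {z. z \<notin> kernel_poles \<beta> \<and> z\<^sup>2 / (of_nat n)\<^sup>2 + 1 - kernel_transform \<alpha> \<beta> z = 0}"

(* Away from the negative axis K(z) = \<pi> / (\<beta> sin (\<pi> r)) z powr (-r) + O(1 / z) for r < 1, and a zero
   z = i n sqrt (1 - K(z)) near i n is i n - i n K(i n) / 2 to leading order.  The factor 1/2 of the
   square root is the 2 in the denominator; without it the expansion in n powr (1 - r) is false. *)
definition spectral_coeff :: "real \<Rightarrow> real \<Rightarrow> real" where
  "spectral_coeff \<beta> r = pi / (2 * \<beta> * sin (pi * r))"

end

theory Submission
  imports Defs
begin

text \<open>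
  Let \<open>K\<close> be the transform and \<open>y = \<i> n\<close>. Away from the poles, a spectral zero is a solution of
  \<open>z\<^sup>2 = y\<^sup>2 (1 - K z)\<close>, and near \<open>y\<close> this is the fixed point equation \<open>z = y csqrt (1 - K z)\<close>.
  Everything is controlled by the one number \<open>\<kappa> = cmod (K y)\<close>: each summand of \<open>- Im (K y)\<close> is
  \<open>n / (k\<^sup>\<alpha> cmod (y + k\<^sup>\<beta>)\<^sup>2)\<close>, so the series that bounds the variation of \<open>K\<close> on the disc
  \<open>cmod (z - y) \<le> n / 2\<close> is at most \<open>4 \<kappa> / n\<close> (\<open>kernel_transform_lipschitz_near_axis\<close>). For small
  \<open>\<kappa>\<close> the fixed point map therefore sends the disc into itself, Brouwer's theorem gives a zero
  \<open>z\<close>, and \<open>csqrt (1 - w) = 1 - w / 2 + O(w\<^sup>2)\<close> yields \<open>z = y - y K(y) / 2 + O(n \<kappa>\<^sup>2)\<close>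
  (\<open>spectral_zero_near_axis\<close>). The second zero is the complex conjugate, because \<open>K\<close> has real
  coefficients.

  It remains to expand \<open>K(\<i> n)\<close> with error \<open>O(1 / n)\<close>, which contributes \<open>O(1)\<close> to \<open>z\<close>. The
  summand, as a function of a real variable \<open>x\<close> in place of \<open>k\<close>, has derivative
  \<open>O(x\<^sup>-\<^sup>\<alpha>\<^sup>-\<^sup>1 / n)\<close>, so the sum agrees up to \<open>O(1 / n)\<close> with the increment over \<open>[1, \<infinity>)\<close> of a
  primitive \<open>F\<close> (\<open>kernel_transform_axis_primitive\<close>). For \<open>r < 1\<close> the substitution
  \<open>w = x\<^sup>2\<^sup>\<beta> / n\<^sup>2\<close> turns real and imaginary part into the integrals of \<open>w\<^sup>s\<^sup>-\<^sup>1 / (1 + w)\<close>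
  with \<open>s = 1 - r/2\<close> and \<open>s = (1 - r)/2\<close>, whose values \<open>\<pi> / sin (\<pi> s)\<close> combine to
  \<open>K(\<i> n) = \<pi> / (\<beta> sin (\<pi> r)) (\<i> n)\<^sup>-\<^sup>r + O(1 / n)\<close>
  (\<open>kernel_transform_axis_asymp_power\<close>). For \<open>r = 1\<close>, that is \<open>\<alpha> = 1\<close>, an elementary primitive gives
  \<open>K(\<i> n) = ln n / (\<i> n \<beta>) + O(1 / n)\<close> (\<open>kernel_transform_axis_asymp_log\<close>). The term \<open>n \<kappa>\<^sup>2\<close> is
  \<open>O(n\<^sup>1\<^sup>-\<^sup>2\<^sup>r)\<close> in the first case and \<open>O((ln n)\<^sup>2 / n)\<close> in the second.

  The fixed point argument needs \<open>\<kappa> \<le> 1/6\<close>, hence large \<open>n\<close>. For the remaining \<open>n\<close> a nonnegative real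
  zero, which is its own conjugate, is supplied by the intermediate value theorem
  (\<open>real_spectral_zero_exists\<close>).
\<close>

section \<open>The transform as a convergent series\<close>

definition kernel_term :: "real \<Rightarrow> real \<Rightarrow> complex \<Rightarrow> nat \<Rightarrow> complex" where
  "kernel_term \<alpha> \<beta> z j =
     1 / (of_real (real (Suc j) powr \<alpha>) * (z + of_real (real (Suc j) powr \<beta>)))"

lemma kernel_transform_eq_suminf: "kernel_transform \<alpha> \<beta> z = (\<Sum>j. kernel_term \<alpha> \<beta> z j)"
  by (simp add: kernel_transform_def kernel_term_def Let_def)

lemma summable_Suc_powr: "p < -1 \<Longrightarrow> summable (\<lambda>j. real (Suc j) powr p)"
  using summable_real_powr_iff[of p] by (subst summable_Suc_iff) simp

lemma cmod_kernel_term_le: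
  assumes "c > 0" and "c * real (Suc j) powr \<beta> \<le> cmod (z + of_real (real (Suc j) powr \<beta>))"
  shows "cmod (kernel_term \<alpha> \<beta> z j) \<le> real (Suc j) powr (- (\<alpha> + \<beta>)) / c"
proof -
  have pos: "0 < c * real (Suc j) powr \<beta>" using assms(1) by simp
  have "cmod (kernel_term \<alpha> \<beta> z j) =
      1 / (real (Suc j) powr \<alpha> * cmod (z + of_real (real (Suc j) powr \<beta>)))"
    by (simp add: kernel_term_def norm_divide norm_mult del: of_nat_Suc)
  also have "\<dots> \<le> 1 / (real (Suc j) powr \<alpha> * (c * real (Suc j) powr \<beta>))"
    using assms pos less_le_trans[OF pos assms(2)]
    by (intro divide_left_mono mult_left_mono mult_pos_pos) (simp_all del: of_nat_Suc)
  also have "\<dots> = real (Suc j) powr (- (\<alpha> + \<beta>)) / c"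
    by (simp add: powr_minus powr_diff inverse_eq_divide del: of_nat_Suc)
  finally show ?thesis .
qed

lemma summable_kernel_term:
  assumes "\<alpha> + \<beta> > 1" "c > 0"
    and "\<And>j. c * real (Suc j) powr \<beta> \<le> cmod (z + of_real (real (Suc j) powr \<beta>))"
  shows "summable (kernel_term \<alpha> \<beta> z)"
proof (rule summable_comparison_test')
  show "summable (\<lambda>j. real (Suc j) powr (- (\<alpha> + \<beta>)) / c)"
    using assms by (intro summable_divide summable_Suc_powr) auto
qed (use assms in \<open>intro cmod_kernel_term_le\<close>)

lemma kernel_transform_cnj:
  assumes "summable (kernel_term \<alpha> \<beta> z)"
  shows "kernel_transform \<alpha> \<beta> (cnj z) = cnj (kernel_transform \<alpha> \<beta> z)"
proof -
  have "(\<lambda>j. cnj (kernel_term \<alpha> \<beta> z j)) sums cnj (\<Sum>j. kernel_term \<alpha> \<beta> z j)"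
    using assms by (subst sums_cnj) (rule summable_sums)
  moreover have "cnj (kernel_term \<alpha> \<beta> z j) = kernel_term \<alpha> \<beta> (cnj z) j" for j
    by (simp add: kernel_term_def)
  ultimately show ?thesis
    by (simp add: kernel_transform_eq_suminf sums_iff)
qed

lemma cnj_mem_spectral_zeros:
  assumes z: "z \<in> spectral_zeros \<alpha> \<beta> n" and sm: "summable (kernel_term \<alpha> \<beta> z)"
  shows "cnj z \<in> spectral_zeros \<alpha> \<beta> n"
proof -
  have "cnj z \<notin> kernel_poles \<beta>"
  proof
    assume "cnj z \<in> kernel_poles \<beta>"
    then obtain k :: nat where k: "k \<ge> 1" "cnj z = - of_real (real k powr \<beta>)"
      unfolding kernel_poles_def by blast
    hence "z = - of_real (real k powr \<beta>)"
      by (metis complex_cnj_cnj complex_cnj_complex_of_real complex_cnj_minus)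
    with k z show False unfolding spectral_zeros_def kernel_poles_def by blast
  qed
  moreover have "(cnj z)\<^sup>2 / (of_nat n)\<^sup>2 + 1 - kernel_transform \<alpha> \<beta> (cnj z)
      = cnj (z\<^sup>2 / (of_nat n)\<^sup>2 + 1 - kernel_transform \<alpha> \<beta> z)"
    by (simp only: kernel_transform_cnj[OF sm] complex_cnj_diff complex_cnj_add complex_cnj_divide
        complex_cnj_power complex_cnj_of_nat complex_cnj_one)
  ultimately show ?thesis
    using z unfolding spectral_zeros_def mem_Collect_eq by (metis complex_cnj_zero)
qed

text \<open>The difference of the \<open>k\<close>-th summands is \<open>(w - z) / (k\<^sup>\<alpha> (z + k\<^sup>\<beta>) (w + k\<^sup>\<beta>))\<close>, so any common lower
  bound \<open>c\<close> for the distances to the poles gives a Lipschitz estimate.\<close>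

lemma cmod_kernel_transform_diff_le:
  assumes sm: "summable (kernel_term \<alpha> \<beta> z)" "summable (kernel_term \<alpha> \<beta> w)"
    and c: "\<And>j. 0 < c j"
      "\<And>j. c j \<le> cmod (z + of_real (real (Suc j) powr \<beta>))"
      "\<And>j. c j \<le> cmod (w + of_real (real (Suc j) powr \<beta>))"
    and sc: "summable (\<lambda>j. 1 / (real (Suc j) powr \<alpha> * (c j)\<^sup>2))"
  shows "cmod (kernel_transform \<alpha> \<beta> z - kernel_transform \<alpha> \<beta> w)
    \<le> cmod (z - w) * (\<Sum>j. 1 / (real (Suc j) powr \<alpha> * (c j)\<^sup>2))"
proof -
  have "cmod (kernel_term \<alpha> \<beta> z j - kernel_term \<alpha> \<beta> w j)
      \<le> cmod (z - w) * (1 / (real (Suc j) powr \<alpha> * (c j)\<^sup>2))" for j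
  proof -
    define k where "k = real (Suc j)"
    let ?z = "z + of_real (k powr \<beta>)" and ?w = "w + of_real (k powr \<beta>)"
    have k: "k > 0" by (simp add: k_def)
    have cz: "0 < c j" "c j \<le> cmod ?z" "c j \<le> cmod ?w" using c by (auto simp: k_def)
    hence nz: "?z \<noteq> 0" "?w \<noteq> 0" by force+
    have "kernel_term \<alpha> \<beta> z j - kernel_term \<alpha> \<beta> w j = (w - z) / (of_real (k powr \<alpha>) * (?z * ?w))"
      unfolding kernel_term_def k_def[symmetric] using nz k by (simp add: divide_simps)
    hence "cmod (kernel_term \<alpha> \<beta> z j - kernel_term \<alpha> \<beta> w j)
        = cmod (z - w) / (k powr \<alpha> * (cmod ?z * cmod ?w))"
      by (simp add: norm_divide norm_mult norm_minus_commute)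
    also have "\<dots> \<le> cmod (z - w) / (k powr \<alpha> * (c j)\<^sup>2)"
      unfolding power2_eq_square using cz k
      by (intro divide_left_mono mult_left_mono mult_mono mult_pos_pos) auto
    finally show ?thesis by (simp add: k_def)
  qed
  moreover have "kernel_transform \<alpha> \<beta> z - kernel_transform \<alpha> \<beta> w
      = (\<Sum>j. kernel_term \<alpha> \<beta> z j - kernel_term \<alpha> \<beta> w j)"
    using sm by (simp add: kernel_transform_eq_suminf suminf_diff)
  ultimately show ?thesis
    using norm_suminf_le[of "\<lambda>j. kernel_term \<alpha> \<beta> z j - kernel_term \<alpha> \<beta> w j"
        "\<lambda>j. cmod (z - w) * (1 / (real (Suc j) powr \<alpha> * (c j)\<^sup>2))"]
      suminf_mult[OF sc, of "cmod (z - w)"] summable_mult[OF sc, of "cmod (z - w)"]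
    by simp
qed

section \<open>Real zeros\<close>

text \<open>On \<open>[0, \<infinity>)\<close> the transform is real and bounded by \<open>\<zeta>(\<alpha> + \<beta>)\<close>, and it takes this value, which is
  at least 1, at 0. Hence \<open>x\<^sup>2 / n\<^sup>2 + 1 - K x\<close> is nonpositive at 0 and nonnegative for large \<open>x\<close>.
  This covers the finitely many \<open>n\<close> that are too small for the fixed point argument.\<close>

lemma real_spectral_zero_exists:
  assumes "\<beta> > 0" "\<alpha> + \<beta> > 1" "n \<ge> 1"
  obtains x :: real where "0 \<le> x" "complex_of_real x \<in> spectral_zeros \<alpha> \<beta> n"
proof -
  define K where "K x = Re (kernel_transform \<alpha> \<beta> (of_real x))" for x :: real
  define M where "M = (\<Sum>j. real (Suc j) powr (- (\<alpha> + \<beta>)))"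
  define f where "f x = x\<^sup>2 / (real n)\<^sup>2 + 1 - K x" for x
  have smM: "summable (\<lambda>j. real (Suc j) powr (- (\<alpha> + \<beta>)))"
    using assms by (intro summable_Suc_powr) auto
  have gap: "real (Suc j) powr \<beta> \<le> cmod (of_real x + of_real (real (Suc j) powr \<beta>))"
    if "0 \<le> x" for x j
    using that by (simp del: of_nat_Suc of_real_add flip: of_real_add)
  have sm: "summable (kernel_term \<alpha> \<beta> (of_real x))" if "0 \<le> x" for x
    using gap[OF that] assms by (intro summable_kernel_term[where c = 1]) auto
  have real: "kernel_transform \<alpha> \<beta> (of_real x) = of_real (K x)" if "0 \<le> x" for x
    using kernel_transform_cnj[OF sm[OF that]] unfolding K_def
    by (simp add: complex_eq_iff)
  have upper: "\<bar>K x\<bar> \<le> M" if "0 \<le> x" for x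
  proof -
    have "cmod (kernel_transform \<alpha> \<beta> (of_real x)) \<le> M"
      unfolding kernel_transform_eq_suminf M_def
      using cmod_kernel_term_le[of 1] gap[OF that]
      by (intro norm_suminf_le smM) (metis div_by_1 mult_1 zero_less_one)
    thus ?thesis by (simp add: real[OF that])
  qed
  have at0: "K 0 \<ge> 1"
  proof -
    have "kernel_term \<alpha> \<beta> 0 j = of_real (real (Suc j) powr (- (\<alpha> + \<beta>)))" for j
      by (simp add: kernel_term_def powr_diff powr_minus inverse_eq_divide del: of_nat_Suc)
    hence "kernel_transform \<alpha> \<beta> 0 = of_real M"
      unfolding kernel_transform_eq_suminf M_def suminf_of_real[OF smM] by (intro suminf_cong)
    hence "K 0 = M" by (simp add: K_def)
    moreover have "(\<Sum>j\<in>{0}. real (Suc j) powr (- (\<alpha> + \<beta>))) \<le> M"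
      unfolding M_def by (intro sum_le_suminf smM) auto
    ultimately show ?thesis by simp
  qed
  have contK: "continuous_on {0..} K"
  proof -
    have eq: "1 / (real (Suc j) powr \<alpha> * (real (Suc j) powr \<beta>)\<^sup>2) = real (Suc j) powr (- (\<alpha> + 2 * \<beta>))" for j
      by (simp add: power2_eq_square powr_minus_divide[symmetric] flip: powr_add del: of_nat_Suc)
    have sc: "summable (\<lambda>j. 1 / (real (Suc j) powr \<alpha> * (real (Suc j) powr \<beta>)\<^sup>2))"
      unfolding eq using assms by (intro summable_Suc_powr) auto
    define L where "L = (\<Sum>j. 1 / (real (Suc j) powr \<alpha> * (real (Suc j) powr \<beta>)\<^sup>2))"
    have "L-lipschitz_on {0..} K"
    proof (rule lipschitz_onI)
      fix x y :: real assume xy: "x \<in> {0..}" "y \<in> {0..}"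
      have "cmod (kernel_transform \<alpha> \<beta> (of_real x) - kernel_transform \<alpha> \<beta> (of_real y))
          \<le> cmod (of_real x - of_real y) * L"
        unfolding L_def using xy by (intro cmod_kernel_transform_diff_le sm sc gap) auto
      thus "dist (K x) (K y) \<le> L * dist x y"
        using xy by (simp add: real dist_real_def mult.commute flip: of_real_diff)
    next
      show "0 \<le> L" unfolding L_def by (intro suminf_nonneg sc) auto
    qed
    thus ?thesis by (rule lipschitz_on_continuous_on)
  qed
  have M: "M \<ge> 1" using at0 upper[of 0] by simp
  have "f 0 \<le> 0" using at0 by (simp add: f_def)
  moreover have "0 \<le> f (n * M)"
  proof -
    have "M * 1 \<le> M * M" using M by (intro mult_left_mono) auto
    moreover have "K (n * M) \<le> M" using upper[of "n * M"] M by simp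
    ultimately show ?thesis using assms by (simp add: f_def power_mult_distrib power2_eq_square)
  qed
  moreover have "continuous_on {0..n * M} f"
    unfolding f_def using assms
    by (intro continuous_intros continuous_on_subset[OF contK]) auto
  ultimately obtain x where x: "0 \<le> x" "f x = 0"
    using IVT'[of f 0 0 "n * M"] M by auto
  have "complex_of_real x \<notin> kernel_poles \<beta>"
  proof
    assume "complex_of_real x \<in> kernel_poles \<beta>"
    then obtain k :: nat where "k \<ge> 1" "complex_of_real x = of_real (- (real k powr \<beta>))"
      unfolding kernel_poles_def by auto
    moreover from this have "x = - (real k powr \<beta>)" unfolding of_real_eq_iff by blast
    ultimately show False using x by (smt (verit) powr_gt_zero of_nat_1 of_nat_mono)
  qed
  moreover have "(of_real x)\<^sup>2 / (of_nat n)\<^sup>2 + 1 - kernel_transform \<alpha> \<beta> (of_real x)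
      = complex_of_real (f x)"
    by (simp add: f_def real[OF x(1)])
  ultimately have "complex_of_real x \<in> spectral_zeros \<alpha> \<beta> n"
    using x by (simp add: spectral_zeros_def)
  with x(1) show ?thesis by (rule that)
qed

section \<open>Variation of the transform near the imaginary axis\<close>

lemma cmod_imaginary_plus_real_ge:
  fixes n x :: real
  assumes "0 < n" "0 \<le> x"
  shows "n \<le> cmod (\<i> * of_real n + of_real x)" "x \<le> cmod (\<i> * of_real n + of_real x)"
  using assms abs_Im_le_cmod[of "\<i> * of_real n + of_real x"]
    abs_Re_le_cmod[of "\<i> * of_real n + of_real x"] by auto

text \<open>Moving \<open>z\<close> by at most \<open>n / 2\<close> cannot cost more than half of the distance to a pole, since that
  distance is at least \<open>n\<close> at \<open>\<i> n\<close>.\<close>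

lemma cmod_near_imaginary_plus_real_ge:
  fixes n x :: real
  assumes "0 < n" "0 \<le> x" "cmod (z - \<i> * of_real n) \<le> n / 2"
  shows "cmod (\<i> * of_real n + of_real x) / 2 \<le> cmod (z + of_real x)"
proof -
  have "cmod (\<i> * of_real n + of_real x) - cmod (z + of_real x)
      \<le> cmod ((\<i> * of_real n + of_real x) - (z + of_real x))"
    by (rule norm_triangle_ineq2)
  also have "\<dots> = cmod (z - \<i> * of_real n)" by (simp add: norm_minus_commute)
  also have "\<dots> \<le> cmod (\<i> * of_real n + of_real x) / 2"
    using assms cmod_imaginary_plus_real_ge(1)[OF assms(1,2)] by simp
  finally show ?thesis by simp
qed

lemma summable_kernel_term_near_axis:
  fixes n :: real
  assumes "\<alpha> + \<beta> > 1" "0 < n" "cmod (z - \<i> * of_real n) \<le> n / 2"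
  shows "summable (kernel_term \<alpha> \<beta> z)"
proof (rule summable_kernel_term[where c = "1/2"])
  fix j
  have "real (Suc j) powr \<beta> / 2 \<le> cmod (\<i> * of_real n + of_real (real (Suc j) powr \<beta>)) / 2"
    using cmod_imaginary_plus_real_ge(2)[OF assms(2), of "real (Suc j) powr \<beta>"] by simp
  also have "\<dots> \<le> cmod (z + of_real (real (Suc j) powr \<beta>))"
    using assms by (intro cmod_near_imaginary_plus_real_ge) auto
  finally show "1 / 2 * real (Suc j) powr \<beta> \<le> cmod (z + of_real (real (Suc j) powr \<beta>))" by simp
qed (use assms in auto)

lemma Im_kernel_term_axis:
  fixes n :: real
  assumes "0 < n"
  shows "- Im (kernel_term \<alpha> \<beta> (\<i> * of_real n) j) = n *
    (1 / (real (Suc j) powr \<alpha> * (cmod (\<i> * of_real n + of_real (real (Suc j) powr \<beta>)))\<^sup>2))"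
proof -
  define k where "k = real (Suc j)"
  have "1 / (of_real (k powr \<alpha>) * (\<i> * of_real n + of_real (k powr \<beta>)))
      = of_real (1 / k powr \<alpha>) * inverse (\<i> * of_real n + of_real (k powr \<beta>))"
    by (simp add: field_simps)
  moreover have "(cmod (\<i> * of_real n + of_real (k powr \<beta>)))\<^sup>2 = (k powr \<beta>)\<^sup>2 + n\<^sup>2"
    by (simp add: cmod_power2)
  ultimately show ?thesis
    unfolding kernel_term_def k_def[symmetric] by simp
qed

text \<open>The sum of \<open>1 / (k\<^sup>\<alpha> cmod (\<i> n + k\<^sup>\<beta>)\<^sup>2)\<close>, which governs the increments of the transform near
  \<open>\<i> n\<close>, equals \<open>- Im (K (\<i> n)) / n\<close>. This expresses the Lipschitz constant by the value of
  the transform at the centre. The factor 4 pays for replacing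
  both distances to a pole by those at the centre.\<close>

lemma kernel_transform_lipschitz_near_axis:
  fixes n :: real
  assumes "\<alpha> + \<beta> > 1" "0 < n"
    and "cmod (z - \<i> * of_real n) \<le> n / 2" "cmod (w - \<i> * of_real n) \<le> n / 2"
  shows "cmod (kernel_transform \<alpha> \<beta> z - kernel_transform \<alpha> \<beta> w)
    \<le> 4 * cmod (kernel_transform \<alpha> \<beta> (\<i> * of_real n)) / n * cmod (z - w)"
proof -
  let ?y = "\<i> * complex_of_real n"
  let ?g = "\<lambda>j. cmod (?y + of_real (real (Suc j) powr \<beta>))"
  define S where "S = (\<Sum>j. 1 / (real (Suc j) powr \<alpha> * (?g j)\<^sup>2))"
  have sy: "summable (kernel_term \<alpha> \<beta> ?y)"
    using assms by (intro summable_kernel_term_near_axis) auto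
  have "(\<lambda>j. - Im (kernel_term \<alpha> \<beta> ?y j)) sums (- Im (kernel_transform \<alpha> \<beta> ?y))"
    unfolding kernel_transform_eq_suminf by (intro sums_minus sums_Im summable_sums sy)
  from sums_divide[OF this, of n]
  have "(\<lambda>j. 1 / (real (Suc j) powr \<alpha> * (?g j)\<^sup>2)) sums (- Im (kernel_transform \<alpha> \<beta> ?y) / n)"
    using assms(2) unfolding Im_kernel_term_axis[OF assms(2)] by simp
  hence sg: "summable (\<lambda>j. 1 / (real (Suc j) powr \<alpha> * (?g j)\<^sup>2))"
    and S: "S = - Im (kernel_transform \<alpha> \<beta> ?y) / n"
    unfolding S_def sums_iff by auto
  have half: "1 / (real (Suc j) powr \<alpha> * (?g j / 2)\<^sup>2) = 4 * (1 / (real (Suc j) powr \<alpha> * (?g j)\<^sup>2))" for j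
    by (simp add: power_divide del: of_nat_Suc)
  have "cmod (kernel_transform \<alpha> \<beta> z - kernel_transform \<alpha> \<beta> w)
    \<le> cmod (z - w) * (\<Sum>j. 1 / (real (Suc j) powr \<alpha> * (?g j / 2)\<^sup>2))"
  proof (rule cmod_kernel_transform_diff_le)
    show "0 < ?g j / 2" for j
      using cmod_imaginary_plus_real_ge(1)[OF assms(2), of "real (Suc j) powr \<beta>"] assms(2)
      by (simp del: of_nat_Suc zero_less_norm_iff)
    show "summable (\<lambda>j. 1 / (real (Suc j) powr \<alpha> * (?g j / 2)\<^sup>2))"
      unfolding half by (intro summable_mult sg)
  qed (use assms in \<open>intro summable_kernel_term_near_axis cmod_near_imaginary_plus_real_ge; simp\<close>)+
  also have "\<dots> = cmod (z - w) * (4 * S)"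
    unfolding half S_def by (subst suminf_mult[OF sg]) simp
  also have "\<dots> \<le> cmod (z - w) * (4 * (cmod (kernel_transform \<alpha> \<beta> ?y) / n))"
    unfolding S using assms(2) abs_Im_le_cmod[of "kernel_transform \<alpha> \<beta> ?y"]
    by (intro mult_left_mono divide_right_mono) auto
  finally show ?thesis by (simp add: mult_ac)
qed

section \<open>Zeros as fixed points\<close>

text \<open>With \<open>s = csqrt (1 - w)\<close> both bounds follow from \<open>s - 1 = - w / (s + 1)\<close>, where the denominator has
  modulus at least 1 because the principal root has nonnegative real part.\<close>

lemma cmod_csqrt_one_minus:
  assumes "cmod w \<le> 1"
  shows "cmod (csqrt (1 - w) - 1) \<le> cmod w"
    and "cmod (csqrt (1 - w) - 1 + w / 2) \<le> (cmod w)\<^sup>2 / 2"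
proof -
  define s where "s = csqrt (1 - w)"
  have "Re (s + 1) \<ge> 1" using csqrt_principal[of "1 - w"] by (auto simp: s_def)
  hence ge1: "cmod (s + 1) \<ge> 1" using complex_Re_le_cmod[of "s + 1"] by linarith
  hence nz: "s + 1 \<noteq> 0" by force
  have sq: "s\<^sup>2 = 1 - w" by (simp add: s_def)
  have e: "s - 1 = - w / (s + 1)"
    using nz sq by (simp add: field_simps power2_eq_square)
  show *: "cmod (csqrt (1 - w) - 1) \<le> cmod w"
    unfolding s_def[symmetric] e using ge1
    by (simp add: norm_divide divide_le_eq mult_le_cancel_left1)
  have "s - 1 + w / 2 = w * (s - 1) / (2 * (s + 1))"
    using nz arg_cong[OF e, of "\<lambda>u. u * (s + 1)"] by (simp add: divide_simps) algebra
  hence "cmod (s - 1 + w / 2) = cmod w * cmod (s - 1) / (2 * cmod (s + 1))"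
    by (simp only: norm_divide norm_mult norm_numeral)
  also have "\<dots> \<le> cmod w * cmod w / (2 * 1)"
    using * ge1 unfolding s_def[symmetric] by (intro frac_le mult_left_mono) auto
  finally show "cmod (csqrt (1 - w) - 1 + w / 2) \<le> (cmod w)\<^sup>2 / 2"
    by (simp add: s_def power2_eq_square)
qed

text \<open>Brouwer's theorem for \<open>T z = y csqrt (1 - K z)\<close> on the disc of radius \<open>n / 2\<close> about \<open>y = \<i> n\<close>. On that
  disc \<open>cmod (K z) \<le> 3 \<kappa> \<le> 1/2\<close>, which keeps \<open>1 - K z\<close> off the branch cut and makes \<open>T\<close> move points
  to a distance at most \<open>3 n \<kappa> \<le> n / 2\<close> from \<open>y\<close>. The constant 11 exceeds
  \<open>9/2\<close>, from the quadratic remainder of the root, plus \<open>6\<close>, from replacing \<open>K z\<close> by \<open>K y\<close>.\<close>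

lemma spectral_zero_near_axis:
  fixes n :: nat and \<kappa> :: real
  assumes "\<alpha> + \<beta> > 1" "n \<ge> 1"
  defines "y \<equiv> \<i> * complex_of_nat n"
  defines "\<kappa> \<equiv> cmod (kernel_transform \<alpha> \<beta> y)"
  assumes small: "\<kappa> \<le> 1 / 6"
  obtains z where "z \<in> spectral_zeros \<alpha> \<beta> n" "cmod (z - y) \<le> n / 2"
    "cmod (z - (y - y * kernel_transform \<alpha> \<beta> y / 2)) \<le> 11 * n * \<kappa>\<^sup>2"
proof -
  let ?K = "kernel_transform \<alpha> \<beta>"
  define B where "B = cball y (real n / 2)"
  define T where "T z = y * csqrt (1 - ?K z)" for z
  have n: "0 < real n" using assms by simp
  have y: "y = \<i> * of_real (real n)" by (simp add: y_def)
  have ny: "cmod y = n" by (simp add: y_def norm_mult)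
  have B: "cmod (z - y) \<le> n / 2" if "z \<in> B" for z
    using that by (simp add: B_def dist_norm norm_minus_commute)
  have lip: "cmod (?K z - ?K w) \<le> 4 * \<kappa> / n * cmod (z - w)" if "z \<in> B" "w \<in> B" for z w
    using kernel_transform_lipschitz_near_axis[OF assms(1) n, of z w] B[OF that(1)] B[OF that(2)]
    unfolding \<kappa>_def y by blast
  have yB: "y \<in> B" by (simp add: B_def)
  have K3: "cmod (?K z) \<le> 3 * \<kappa>" if z: "z \<in> B" for z
  proof -
    have "cmod (?K z) \<le> \<kappa> + cmod (?K z - ?K y)"
      unfolding \<kappa>_def by (rule norm_triangle_sub)
    also have "cmod (?K z - ?K y) \<le> 4 * \<kappa> / n * cmod (z - y)"
      by (rule lip[OF z yB])
    also have "\<dots> \<le> 4 * \<kappa> / n * (n / 2)"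
      using B[OF z] n by (intro mult_left_mono) (auto simp: \<kappa>_def)
    finally show ?thesis using n by simp
  qed
  have move: "cmod (T z - y) \<le> n * (3 * \<kappa>)" if z: "z \<in> B" for z
  proof -
    have "T z - y = y * (csqrt (1 - ?K z) - 1)" by (simp add: T_def algebra_simps)
    hence "cmod (T z - y) = n * cmod (csqrt (1 - ?K z) - 1)"
      by (simp only: norm_mult ny)
    also have "\<dots> \<le> n * (3 * \<kappa>)"
      using K3[OF z] small cmod_csqrt_one_minus(1)[of "?K z"] by (intro mult_left_mono) auto
    finally show ?thesis .
  qed
  have "continuous_on B ?K"
  proof (rule lipschitz_on_continuous_on)
    show "(4 * \<kappa> / n)-lipschitz_on B ?K"
      using lip n by (intro lipschitz_onI) (auto simp: dist_norm \<kappa>_def)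
  qed
  moreover have "1 - ?K z \<in> - \<real>\<^sub>\<le>\<^sub>0" if "z \<in> B" for z
    using K3[OF that] small complex_Re_le_cmod[of "?K z"] by (auto simp: complex_nonpos_Reals_iff)
  ultimately have contT: "continuous_on B T"
    unfolding T_def
    by (intro continuous_on_mult_left continuous_on_compose2[OF continuous_on_csqrt]
        continuous_on_diff continuous_on_const) auto
  have "T \<in> B \<rightarrow> B"
  proof
    fix z assume z: "z \<in> B"
    have "n * (3 * \<kappa>) \<le> n * (1 / 2)" using small by (intro mult_left_mono) auto
    with move[OF z] show "T z \<in> B"
      by (simp add: B_def dist_norm norm_minus_commute)
  qed
  then obtain z where z: "z \<in> B" and fixed: "T z = z"
    using brouwer_ball[of "real n / 2" y T] contT n unfolding B_def by auto
  \<comment> \<open>The poles are real, whereas the disc stays off the real axis.\<close>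
  have "z \<notin> kernel_poles \<beta>"
  proof
    assume "z \<in> kernel_poles \<beta>"
    hence "Im z = 0" unfolding kernel_poles_def by auto
    hence "n \<le> cmod (z - y)" using abs_Im_le_cmod[of "z - y"] by (simp add: y_def)
    with B[OF z] n show False by simp
  qed
  moreover have "z\<^sup>2 / (of_nat n)\<^sup>2 + 1 - ?K z = 0"
  proof -
    have "z\<^sup>2 = y\<^sup>2 * (1 - ?K z)"
      using arg_cong[OF fixed, of "\<lambda>u. u\<^sup>2"] by (simp add: T_def power_mult_distrib)
    thus ?thesis using n by (simp add: y_def power_mult_distrib field_simps)
  qed
  ultimately have "z \<in> spectral_zeros \<alpha> \<beta> n" by (simp add: spectral_zeros_def)
  moreover have "cmod (z - (y - y * ?K y / 2)) \<le> 11 * n * \<kappa>\<^sup>2"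
  proof -
    have "z - (y - y * ?K y / 2) =
        y * (csqrt (1 - ?K z) - 1 + ?K z / 2) - y * (?K z - ?K y) / 2"
      by (subst (1) fixed[symmetric]) (simp add: T_def right_diff_distrib distrib_left diff_divide_distrib)
    hence "cmod (z - (y - y * ?K y / 2)) \<le>
        cmod (y * (csqrt (1 - ?K z) - 1 + ?K z / 2)) + cmod (y * (?K z - ?K y) / 2)"
      by (simp only: norm_triangle_ineq4)
    also have "\<dots> = n * cmod (csqrt (1 - ?K z) - 1 + ?K z / 2) + n * cmod (?K z - ?K y) / 2"
      by (simp only: norm_mult norm_divide ny norm_numeral)
    also have "\<dots> \<le> n * ((3 * \<kappa>)\<^sup>2 / 2) + n * (4 * \<kappa> / n * (n * (3 * \<kappa>))) / 2"
    proof (intro add_mono mult_left_mono divide_right_mono)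
      have "cmod (csqrt (1 - ?K z) - 1 + ?K z / 2) \<le> (cmod (?K z))\<^sup>2 / 2"
        using K3[OF z] small by (intro cmod_csqrt_one_minus) auto
      also have "\<dots> \<le> (3 * \<kappa>)\<^sup>2 / 2"
        using K3[OF z] by (intro divide_right_mono power_mono) auto
      finally show "cmod (csqrt (1 - ?K z) - 1 + ?K z / 2) \<le> (3 * \<kappa>)\<^sup>2 / 2" .
      have "cmod (?K z - ?K y) \<le> 4 * \<kappa> / n * cmod (z - y)" by (rule lip[OF z yB])
      also have "\<dots> \<le> 4 * \<kappa> / n * (n * (3 * \<kappa>))"
        using move[OF z] by (intro mult_left_mono) (auto simp: fixed \<kappa>_def)
      finally show "cmod (?K z - ?K y) \<le> 4 * \<kappa> / n * (n * (3 * \<kappa>))" .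
    qed auto
    also have "\<dots> \<le> 11 * n * \<kappa>\<^sup>2"
      using n by (simp add: power2_eq_square field_simps \<kappa>_def)
    finally show ?thesis .
  qed
  ultimately show ?thesis using B[OF z] that by blast
qed

section \<open>Comparison of the series with an integral\<close>

text \<open>Comparison of the sum with the integral, the integral being given by a primitive \<open>F\<close> of the summand
  with limit \<open>L\<close>. As the
  real part of the summand need not be monotone, the comparison goes through its derivative. With
  \<open>g = cmod (\<i> n + x\<^sup>\<beta>)\<close>, which is at least \<open>n\<close> and at least \<open>x\<^sup>\<beta>\<close>, the derivative of the summand is at
  most \<open>\<alpha> x\<^sup>-\<^sup>\<alpha>\<^sup>-\<^sup>1 / g + \<beta> x\<^sup>\<beta>\<^sup>-\<^sup>\<alpha>\<^sup>-\<^sup>1 / g\<^sup>2\<close>, hence \<open>(\<alpha> + \<beta>) x\<^sup>-\<^sup>\<alpha>\<^sup>-\<^sup>1 / n\<close>; this is summable over \<open>k\<close>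
  because \<open>\<alpha> > 0\<close>, and the increments of \<open>F\<close> telescope.\<close>

lemma kernel_transform_axis_primitive:
  fixes n :: real and F :: "real \<Rightarrow> complex"
  assumes \<alpha>\<beta>: "0 < \<alpha>" "0 < \<beta>" "\<alpha> + \<beta> > 1" and n: "0 < n"
    and F: "\<And>x. 1 \<le> x \<Longrightarrow> (F has_vector_derivative
        1 / (of_real (x powr \<alpha>) * (\<i> * of_real n + of_real (x powr \<beta>)))) (at x)"
    and L: "(F \<longlongrightarrow> L) at_top"
  shows "cmod (kernel_transform \<alpha> \<beta> (\<i> * of_real n) - (L - F 1))
    \<le> (\<alpha> + \<beta>) * (\<Sum>j. real (Suc j) powr (- \<alpha> - 1)) / n"
proof -
  let ?y = "\<i> * complex_of_real n"
  define f where "f x = of_real (x powr (- \<alpha>)) * inverse (?y + of_real (x powr \<beta>))" for x :: real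
  define f' where "f' x = of_real (x powr (- \<alpha>)) *
      (of_real (\<beta> * x powr (\<beta> - 1)) * - (inverse (?y + of_real (x powr \<beta>)))\<^sup>2)
      + of_real (- \<alpha> * x powr (- \<alpha> - 1)) * inverse (?y + of_real (x powr \<beta>))" for x :: real
  have f_eq: "1 / (of_real (x powr \<alpha>) * (?y + of_real (x powr \<beta>))) = f x" for x
    by (simp add: f_def powr_minus field_simps)
  have gap: "n \<le> cmod (?y + of_real (x powr \<beta>))" "x powr \<beta> \<le> cmod (?y + of_real (x powr \<beta>))" for x
    using cmod_imaginary_plus_real_ge[OF n] by auto
  have nz: "?y + of_real (x powr \<beta>) \<noteq> 0" for x
    using gap(1)[of x] n by (metis norm_zero not_le)
  have df: "(f has_vector_derivative f' x) (at x)" if "0 < x" for x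
  proof -
    have "((\<lambda>x. ?y + of_real (x powr \<beta>)) has_vector_derivative of_real (\<beta> * x powr (\<beta> - 1))) (at x)"
      using that by (auto intro!: derivative_eq_intros)
    moreover have "(inverse has_field_derivative - (inverse (?y + of_real (x powr \<beta>)))\<^sup>2)
        (at (?y + of_real (x powr \<beta>)))"
      using DERIV_inverse[OF nz] by (simp add: numeral_2_eq_2)
    ultimately have "((\<lambda>x. inverse (?y + of_real (x powr \<beta>))) has_vector_derivative
        of_real (\<beta> * x powr (\<beta> - 1)) * - (inverse (?y + of_real (x powr \<beta>)))\<^sup>2) (at x)"
      using field_vector_diff_chain_at unfolding o_def by blast
    moreover have "((\<lambda>x. complex_of_real (x powr - \<alpha>)) has_vector_derivative
        of_real (- \<alpha> * x powr (- \<alpha> - 1))) (at x)"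
      using that by (auto intro!: derivative_eq_intros)
    ultimately show ?thesis
      unfolding f_def[abs_def] f'_def by (intro has_vector_derivative_mult)
  qed
  have bound: "cmod (f' x) \<le> (\<alpha> + \<beta>) / n * x powr (- \<alpha> - 1)" if x: "0 < x" for x
  proof -
    define g where "g = cmod (?y + of_real (x powr \<beta>))"
    have g: "0 < g" "n \<le> g" "x powr \<beta> \<le> g" using gap[of x] n by (auto simp: g_def)
    have "cmod (f' x) \<le> x powr (- \<alpha>) * (\<beta> * x powr (\<beta> - 1) * (inverse g)\<^sup>2)
        + \<alpha> * x powr (- \<alpha> - 1) * inverse g"
      unfolding f'_def g_def using \<alpha>\<beta>
      by (intro order.trans[OF norm_triangle_ineq])
        (simp add: norm_mult norm_inverse norm_power)
    also have "x powr (- \<alpha>) * (\<beta> * x powr (\<beta> - 1) * (inverse g)\<^sup>2)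
        = \<beta> * x powr (- \<alpha> - 1) * (x powr \<beta> / g * (1 / g))"
      using x by (simp add: powr_diff power2_eq_square field_simps)
    also have "\<dots> \<le> \<beta> * x powr (- \<alpha> - 1) * (1 * (1 / n))"
      using g n \<alpha>\<beta> by (intro mult_left_mono mult_mono divide_left_mono) auto
    also have "\<alpha> * x powr (- \<alpha> - 1) * inverse g \<le> \<alpha> * x powr (- \<alpha> - 1) * inverse n"
      using g n \<alpha>\<beta> by (intro mult_left_mono le_imp_inverse_le) auto
    finally show ?thesis by (simp add: field_simps add_divide_distrib)
  qed
  have step: "cmod (f (real (Suc j)) - (F (real (Suc (Suc j))) - F (real (Suc j))))
      \<le> (\<alpha> + \<beta>) / n * real (Suc j) powr (- \<alpha> - 1)" for j
  proof -
    define k where "k = real (Suc j)"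
    define B where "B = (\<alpha> + \<beta>) / n * k powr (- \<alpha> - 1)"
    have k: "1 \<le> k" by (simp add: k_def)
    have B0: "0 \<le> B" using \<alpha>\<beta> n by (simp add: B_def)
    have var: "cmod (f x - f k) \<le> B" if x: "x \<in> {k..k+1}" for x
    proof -
      have "cmod (f x - f k) \<le> B * norm (x - k)"
      proof (rule differentiable_bound[where S = "{k..k+1}"])
        fix t assume t: "t \<in> {k..k+1}"
        show "(f has_derivative (\<lambda>h. h *\<^sub>R f' t)) (at t within {k..k+1})"
          using df[of t] t k has_derivative_at_withinI
          unfolding has_vector_derivative_def by fastforce
        have "cmod (f' t) \<le> (\<alpha> + \<beta>) / n * t powr (- \<alpha> - 1)" using t k by (intro bound) auto
        also have "\<dots> \<le> B"
          unfolding B_def using t k \<alpha>\<beta> n by (intro mult_left_mono powr_mono2') auto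
        finally show "onorm (\<lambda>h. h *\<^sub>R f' t) \<le> B"
          by (intro onorm_le) (simp add: mult.commute[of B] mult_left_mono)
      qed (use x k in auto)
      also have "\<dots> \<le> B * 1" using x B0 by (intro mult_left_mono) auto
      finally show ?thesis by simp
    qed
    have "cmod (F (k + 1) - F k - (k + 1 - k) *\<^sub>R f k) \<le> norm (k + 1 - k) * B"
    proof (rule vector_differentiable_bound_linearization[where S = "{k..k+1}"])
      show "(F has_vector_derivative f x) (at x within {k..k+1})" if "x \<in> {k..k+1}" for x
        using F[of x] that k has_vector_derivative_at_within unfolding f_eq by fastforce
    qed (use var in \<open>auto simp: closed_segment_eq_real_ivl\<close>)
    thus ?thesis by (simp add: k_def B_def norm_minus_commute add_ac)
  qed
  have sm: "summable (kernel_term \<alpha> \<beta> ?y)"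
    using \<alpha>\<beta> n by (intro summable_kernel_term_near_axis[OF _ n]) auto
  have "(\<lambda>j. F (real (Suc j))) \<longlonglongrightarrow> L"
    by (rule filterlim_compose[OF L]) (rule filterlim_compose[OF filterlim_real_sequentially filterlim_Suc])
  hence tele: "(\<lambda>j. F (real (Suc (Suc j))) - F (real (Suc j))) sums (L - F (real (Suc 0)))"
    by (rule telescope_sums)
  have "kernel_term \<alpha> \<beta> ?y = (\<lambda>j. f (real (Suc j)))"
    by (simp add: fun_eq_iff kernel_term_def f_eq del: of_nat_Suc)
  hence "(\<lambda>j. f (real (Suc j))) sums kernel_transform \<alpha> \<beta> ?y"
    using summable_sums[OF sm] by (simp add: kernel_transform_eq_suminf)
  from sums_diff[OF this tele]
  have "kernel_transform \<alpha> \<beta> ?y - (L - F 1) =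
      (\<Sum>j. f (real (Suc j)) - (F (real (Suc (Suc j))) - F (real (Suc j))))"
    by (simp add: sums_iff)
  moreover have sp: "summable (\<lambda>j. real (Suc j) powr (- \<alpha> - 1))"
    using \<alpha>\<beta> by (intro summable_Suc_powr) auto
  ultimately have "cmod (kernel_transform \<alpha> \<beta> ?y - (L - F 1)) \<le>
      (\<Sum>j. (\<alpha> + \<beta>) / n * real (Suc j) powr (- \<alpha> - 1))"
    using norm_suminf_le[OF step summable_mult[OF sp]] by simp
  also have "\<dots> = (\<alpha> + \<beta>) / n * (\<Sum>j. real (Suc j) powr (- \<alpha> - 1))"
    by (rule suminf_mult[OF sp])
  finally show ?thesis by simp
qed

section \<open>The transform on the imaginary axis\<close>

text \<open>A primitive of \<open>w\<^sup>s\<^sup>-\<^sup>1 / (1 + w)\<close> that vanishes at 0 to order \<open>s\<close>: the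
  substitution \<open>t = w / (1 + w)\<close> maps the half line to
  \<open>[0, 1)\<close> and turns the integrand into that of \<open>Beta s (1 - s)\<close>, which is \<open>\<pi> / sin (\<pi> s)\<close> by the
  reflection formula. Working with a primitive instead of an improper integral is what the comparison
  with the sum requires.\<close>

lemma powr_over_one_plus_primitive:
  fixes s :: real
  assumes s: "0 < s" "s < 1"
  obtains P :: "real \<Rightarrow> real" where
    "\<And>w. 0 < w \<Longrightarrow> (P has_real_derivative w powr (s - 1) / (1 + w)) (at w)"
    "(P \<longlongrightarrow> pi / sin (pi * s)) at_top"
    "\<And>w. 0 < w \<Longrightarrow> \<bar>P w\<bar> \<le> w powr s / s"
proof -
  define h where "h t = t powr (s - 1) * (1 - t) powr ((1 - s) - 1)" for t :: real
  define P where "P w = integral {0..w / (1 + w)} h" for w :: real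
  have int: "(h has_integral Beta s (1 - s)) {0..1}"
    unfolding h_def by (rule has_integral_Beta_real) (use s in auto)
  have Beta: "Beta s (1 - s) = pi / sin (pi * s)"
  proof -
    have "complex_of_real (Gamma s * Gamma (1 - s)) = Gamma (of_real s) * Gamma (1 - of_real s)"
      by (simp only: of_real_mult Gamma_complex_of_real[symmetric] of_real_diff of_real_1)
    also have "\<dots> = of_real pi / sin (of_real pi * of_real s)"
      by (rule Gamma_reflection_complex)
    also have "\<dots> = of_real (pi / sin (pi * s))"
      by (simp only: of_real_divide of_real_mult sin_of_real[symmetric])
    finally have "complex_of_real (Gamma s * Gamma (1 - s)) = of_real (pi / sin (pi * s))" .
    hence "Gamma s * Gamma (1 - s) = pi / sin (pi * s)"
      unfolding of_real_eq_iff .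
    thus ?thesis by (simp add: Beta_def)
  qed
  have cont: "continuous_on {0..1} (\<lambda>y. integral {0..y} h)"
    using int by (intro indefinite_integral_continuous_1) blast
  have unit: "w / (1 + w) \<in> {0..1}" if "0 \<le> w" for w :: real
    using that by (auto simp: divide_simps)
  have deriv: "(P has_real_derivative w powr (s - 1) / (1 + w)) (at w)" if w: "0 < w" for w
  proof -
    define y where "y = w / (1 + w)"
    have y: "0 < y" "y < 1" "1 - y = 1 / (1 + w)" using w by (auto simp: y_def field_simps)
    have "isCont h y"
      unfolding h_def[abs_def] isCont_def using y
      by (intro tendsto_mult tendsto_powr tendsto_diff tendsto_const tendsto_ident_at) auto
    hence "((\<lambda>u. integral {0..u} h) has_vector_derivative h y) (at y within ({0..1} - {}))"
      using has_integral_integrable[OF int] y continuous_at_imp_continuous_within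
      by (intro integral_has_vector_derivative_continuous_at) auto
    hence *: "((\<lambda>u. integral {0..u} h) has_real_derivative h y) (at y)"
      using y by (simp add: has_real_derivative_iff_has_vector_derivative at_within_Icc_at)
    have "((\<lambda>w. w / (1 + w)) has_real_derivative 1 / (1 + w)^2) (at w)"
      using w by (auto intro!: derivative_eq_intros simp: field_simps power2_eq_square)
    from DERIV_chain2[OF *[unfolded y_def] this]
    have "(P has_real_derivative h y * (1 / (1 + w)^2)) (at w)"
      by (simp add: P_def[abs_def] y_def)
    also have "h y * (1 / (1 + w)^2) = w powr (s - 1) / (1 + w)"
    proof -
      have "h y = w powr (s - 1) / (1 + w) powr (s - 1) * (1 / (1 + w) powr (-s))"
        using w unfolding h_def y(3) unfolding y_def by (simp add: powr_divide)
      also have "\<dots> = w powr (s - 1) / ((1 + w) powr (s - 1) * (1 + w) powr (-s))"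
        by simp
      also have "(1 + w) powr (s - 1) * (1 + w) powr (-s) = (1 + w) powr (-1)"
        by (simp flip: powr_add)
      also have "\<dots> = 1 / (1 + w)" using w by (simp add: powr_minus_divide)
      finally show ?thesis using w by (simp add: power2_eq_square)
    qed
    finally show ?thesis .
  qed
  have lim: "(P \<longlongrightarrow> pi / sin (pi * s)) at_top"
  proof -
    have "((\<lambda>w::real. 1 - inverse (1 + w)) \<longlongrightarrow> 1 - 0) at_top"
      by (intro tendsto_diff tendsto_const tendsto_inverse_0_at_top
          filterlim_tendsto_add_at_top[OF tendsto_const] filterlim_ident)
    moreover have "\<forall>\<^sub>F w in at_top. 1 - inverse (1 + w) = w / (1 + w :: real)"
      using eventually_gt_at_top[of "0::real"] by eventually_elim (simp add: field_simps)
    ultimately have "((\<lambda>w::real. w / (1 + w)) \<longlongrightarrow> 1 - 0) at_top"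
      by (rule Lim_transform_eventually)
    moreover have "\<forall>\<^sub>F w in at_top. w / (1 + w) \<in> {0..1::real}"
      using eventually_ge_at_top[of "0::real"] by eventually_elim (rule unit)
    ultimately have "(P \<longlongrightarrow> integral {0..1} h) at_top"
      unfolding P_def[abs_def] by (intro continuous_on_tendsto_compose[OF cont]) auto
    thus ?thesis using integral_unique[OF int] Beta by simp
  qed
  have bound: "\<bar>P w\<bar> \<le> w powr s / s" if w: "0 < w" for w
  proof -
    have "P w \<ge> 0"
    proof -
      have "h integrable_on {0..w / (1 + w)}"
        using unit[of w] w by (intro integrable_subinterval_real[OF has_integral_integrable[OF int]]) auto
      thus ?thesis unfolding P_def by (intro integral_nonneg) (auto simp: h_def)
    qed
    moreover have "0 powr s / s - P 0 < w powr s / s - P w"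
    proof (rule DERIV_pos_imp_increasing_open[OF w])
      fix x assume x: "0 < x" "x < w"
      have "((\<lambda>x. x powr s / s - P x) has_real_derivative
          x powr (s - 1) - x powr (s - 1) / (1 + x)) (at x)"
        using x s by (auto intro!: derivative_eq_intros deriv)
      moreover have "x powr (s - 1) - x powr (s - 1) / (1 + x) > 0"
        using x by (simp add: field_simps)
      ultimately show "\<exists>y. ((\<lambda>x. x powr s / s - P x) has_real_derivative y) (at x) \<and> 0 < y"
        by blast
    next
      have "continuous_on {0..w} P"
        unfolding P_def[abs_def] using unit w
        by (intro continuous_on_compose2[OF cont]) (auto intro!: continuous_intros)
      thus "continuous_on {0..w} (\<lambda>x. x powr s / s - P x)"
        using s by (auto intro!: continuous_on_diff continuous_on_divide continuous_on_powr')
    qed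
    ultimately show ?thesis using s by (simp add: P_def)
  qed
  show ?thesis using deriv lim bound by (rule that)
qed

text \<open>The summand is \<open>x\<^sup>-\<^sup>\<alpha> (x\<^sup>\<beta> - \<i> n) / (n\<^sup>2 + x\<^sup>2\<^sup>\<beta>)\<close>. In the variable \<open>w = x\<^sup>2\<^sup>\<beta> / n\<^sup>2\<close> its real and
  imaginary part become \<open>w\<^sup>s\<^sup>-\<^sup>1 / (1 + w)\<close> up to the sign and the factor \<open>n\<^sup>-\<^sup>r / (2 \<beta>)\<close>, where
  \<open>s\<close> is \<open>1 - r/2\<close> and \<open>(1 - r)/2\<close> respectively; both lie strictly between 0 and 1 because \<open>0 < r < 1\<close>. The value of the primitive at \<open>x = 1\<close>,
  the integral over the missing interval \<open>[0, 1]\<close>, is itself \<open>O(1 / n)\<close>.\<close>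

lemma kernel_transform_axis_asymp_power:
  fixes \<alpha> \<beta> r :: real
  assumes \<alpha>: "0 < \<alpha>" "\<alpha> < 1" and \<alpha>\<beta>: "\<alpha> + \<beta> > 1" and r: "r = (\<alpha> + \<beta> - 1) / \<beta>"
  obtains C where "0 \<le> C" and
    "\<And>n::real. 1 \<le> n \<Longrightarrow> cmod (kernel_transform \<alpha> \<beta> (\<i> * of_real n) -
        of_real (pi / (\<beta> * sin (pi * r))) * exp (- \<i> * of_real (r * pi / 2)) * of_real (n powr (- r)))
      \<le> C / n"
proof -
  have \<beta>: "0 < \<beta>" using \<alpha> \<alpha>\<beta> by simp
  have r01: "0 < r" "r < 1" using \<alpha> \<alpha>\<beta> \<beta> by (auto simp: r field_simps)
  have r\<beta>: "r * \<beta> = \<alpha> + \<beta> - 1" using \<beta> by (simp add: r)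
  define s\<^sub>1 s\<^sub>2 where "s\<^sub>1 = 1 - r / 2" and "s\<^sub>2 = (1 - r) / 2"
  have s: "0 < s\<^sub>1" "s\<^sub>1 < 1" "0 < s\<^sub>2" "s\<^sub>2 < 1" using r01 by (auto simp: s\<^sub>1_def s\<^sub>2_def)
  obtain P\<^sub>1 where P\<^sub>1: "\<And>w. 0 < w \<Longrightarrow> (P\<^sub>1 has_real_derivative w powr (s\<^sub>1 - 1) / (1 + w)) (at w)"
      "(P\<^sub>1 \<longlongrightarrow> pi / sin (pi * s\<^sub>1)) at_top" "\<And>w. 0 < w \<Longrightarrow> \<bar>P\<^sub>1 w\<bar> \<le> w powr s\<^sub>1 / s\<^sub>1"
    using powr_over_one_plus_primitive s by metis
  obtain P\<^sub>2 where P\<^sub>2: "\<And>w. 0 < w \<Longrightarrow> (P\<^sub>2 has_real_derivative w powr (s\<^sub>2 - 1) / (1 + w)) (at w)"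
      "(P\<^sub>2 \<longlongrightarrow> pi / sin (pi * s\<^sub>2)) at_top" "\<And>w. 0 < w \<Longrightarrow> \<bar>P\<^sub>2 w\<bar> \<le> w powr s\<^sub>2 / s\<^sub>2"
    using powr_over_one_plus_primitive s by metis
  define C where "C = (\<alpha> + \<beta>) * (\<Sum>j. real (Suc j) powr (- \<alpha> - 1)) + (1 / s\<^sub>1 + 1 / s\<^sub>2) / (2 * \<beta>)"
  have "0 \<le> (\<Sum>j. real (Suc j) powr (- \<alpha> - 1))"
    using \<alpha> by (intro suminf_nonneg summable_Suc_powr) auto
  hence C0: "0 \<le> C" unfolding C_def using \<alpha> \<beta> s by auto
  show ?thesis
  proof (rule that[OF C0])
    fix n :: real assume n: "1 \<le> n"
    let ?y = "\<i> * complex_of_real n"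
    define W where "W x = x powr (2 * \<beta>) * n powr (- 2)" for x :: real
    define c where "c = n powr (- r) / (2 * \<beta>)"
    define F where "F x = of_real (c * P\<^sub>1 (W x)) - \<i> * of_real (c * P\<^sub>2 (W x))" for x
    define L where "L = of_real (c * (pi / sin (pi * s\<^sub>1))) - \<i> * of_real (c * (pi / sin (pi * s\<^sub>2)))"
    \<comment> \<open>One computation for both parts; \<open>s = s\<^sub>1\<close> gives the real part and \<open>s = s\<^sub>2\<close> the imaginary one.\<close>
    have cW: "((\<lambda>x. c * P (W x)) has_real_derivative
        n powr (2 - r - 2 * s) * x powr (2 * \<beta> * s - 1) / (n\<^sup>2 + (x powr \<beta>)\<^sup>2)) (at x)"
      if P: "\<And>w. 0 < w \<Longrightarrow> (P has_real_derivative w powr (s - 1) / (1 + w)) (at w)" and x: "0 < x"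
      for P s x
    proof -
      have W0: "0 < W x" using x n by (simp add: W_def)
      have "(W has_real_derivative 2 * \<beta> * x powr (2 * \<beta> - 1) * n powr (- 2)) (at x)"
        unfolding W_def[abs_def] using x by (auto intro!: derivative_eq_intros)
      from DERIV_cmult[OF DERIV_chain2[OF P[OF W0] this], of c]
      have "((\<lambda>x. c * P (W x)) has_real_derivative
          c * (W x powr (s - 1) / (1 + W x) * (2 * \<beta> * x powr (2 * \<beta> - 1) * n powr (- 2)))) (at x)" .
      also have "c * (W x powr (s - 1) / (1 + W x) * (2 * \<beta> * x powr (2 * \<beta> - 1) * n powr (- 2)))
          = (n powr (- r) * n powr (- 2 * (s - 1))) * (x powr (2 * \<beta> * (s - 1)) * x powr (2 * \<beta> - 1))
            * (n powr (- 2) / (1 + W x))"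
        using \<beta> by (simp add: c_def W_def powr_mult powr_powr)
      also have "n powr (- r) * n powr (- 2 * (s - 1)) = n powr (2 - r - 2 * s)"
        by (simp add: algebra_simps flip: powr_add)
      also have "x powr (2 * \<beta> * (s - 1)) * x powr (2 * \<beta> - 1) = x powr (2 * \<beta> * s - 1)"
        by (simp add: algebra_simps flip: powr_add)
      also have "n powr (- 2) / (1 + W x) = 1 / (n\<^sup>2 + (x powr \<beta>)\<^sup>2)"
      proof -
        have "x powr (2 * \<beta>) = (x powr \<beta>)\<^sup>2"
          by (simp add: power2_eq_square flip: powr_add)
        moreover have "n powr (- 2) = 1 / n\<^sup>2" using n by (simp add: powr_minus_divide)
        ultimately have "1 + W x = (n\<^sup>2 + (x powr \<beta>)\<^sup>2) / n\<^sup>2" "n powr (- 2) = 1 / n\<^sup>2"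
          using n by (simp_all only: W_def) (simp add: field_simps)
        thus ?thesis using n by simp
      qed
      finally show ?thesis by (simp add: mult_ac)
    qed
    have dF: "(F has_vector_derivative 1 / (of_real (x powr \<alpha>) * (?y + of_real (x powr \<beta>)))) (at x)"
      if x: "1 \<le> x" for x
    proof -
      have e1: "2 - r - 2 * s\<^sub>1 = 0" "2 * \<beta> * s\<^sub>1 - 1 = \<beta> - \<alpha>"
        using r\<beta> by (auto simp: s\<^sub>1_def algebra_simps)
      have e2: "2 - r - 2 * s\<^sub>2 = 1" "2 * \<beta> * s\<^sub>2 - 1 = - \<alpha>"
        using r\<beta> by (auto simp: s\<^sub>2_def field_simps)
      define q where "q = n\<^sup>2 + (x powr \<beta>)\<^sup>2"
      have q: "q > 0" using n by (auto simp: q_def intro!: add_pos_nonneg)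
      have "(F has_vector_derivative (of_real (x powr (\<beta> - \<alpha>) / q) - \<i> * of_real (n * x powr (- \<alpha>) / q))) (at x)"
        unfolding F_def[abs_def] q_def using cW[of P\<^sub>1 s\<^sub>1 x] cW[of P\<^sub>2 s\<^sub>2 x] P\<^sub>1(1) P\<^sub>2(1) x n
        by (intro has_vector_derivative_diff has_vector_derivative_mult_right has_vector_derivative_of_real)
          (simp_all add: e1 e2)
      also have "of_real (x powr (\<beta> - \<alpha>) / q) - \<i> * of_real (n * x powr (- \<alpha>) / q)
          = of_real (x powr (- \<alpha>) / q) * (of_real (x powr \<beta>) - ?y)"
        by (simp add: powr_diff powr_minus field_simps diff_divide_distrib)
      also have "\<dots> = 1 / (of_real (x powr \<alpha>) * (?y + of_real (x powr \<beta>)))"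
      proof -
        have "(of_real (x powr \<beta>) - ?y) * (?y + of_real (x powr \<beta>)) = of_real q"
          by (simp add: q_def algebra_simps power2_eq_square)
        moreover have "?y + of_real (x powr \<beta>) \<noteq> 0" using n by (simp add: complex_eq_iff)
        moreover have "complex_of_real q \<noteq> 0" using q by simp
        moreover have "x powr \<alpha> \<noteq> 0" using x by simp
        ultimately show ?thesis by (simp add: powr_minus divide_simps)
      qed
      finally show ?thesis .
    qed
    have Wtop: "filterlim W at_top at_top"
    proof -
      have "filterlim (\<lambda>x. exp (2 * \<beta> * ln x) * n powr (- 2)) at_top at_top"
        using n \<beta> by (intro filterlim_at_top_mult_tendsto_pos[OF tendsto_const]
            filterlim_compose[OF exp_at_top] filterlim_tendsto_pos_mult_at_top[OF tendsto_const] ln_at_top) auto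
      moreover have "\<forall>\<^sub>F x in at_top. exp (2 * \<beta> * ln x) * n powr (- 2) = W x"
        using eventually_gt_at_top[of "0::real"] by eventually_elim (simp add: W_def powr_def)
      ultimately show ?thesis by (rule filterlim_cong[OF refl refl, THEN iffD1, rotated])
    qed
    have limF: "(F \<longlongrightarrow> L) at_top"
      unfolding F_def[abs_def] L_def
      by (intro tendsto_intros filterlim_compose[OF P\<^sub>1(2) Wtop] filterlim_compose[OF P\<^sub>2(2) Wtop])
    have "cmod (kernel_transform \<alpha> \<beta> ?y - (L - F 1))
        \<le> (\<alpha> + \<beta>) * (\<Sum>j. real (Suc j) powr (- \<alpha> - 1)) / n"
      using \<alpha> \<beta> \<alpha>\<beta> n dF limF by (intro kernel_transform_axis_primitive) auto
    moreover have "cmod (F 1) \<le> (1 / s\<^sub>1 + 1 / s\<^sub>2) / (2 * \<beta>) / n"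
    proof -
      have W1: "W 1 = n powr (- 2)" by (simp add: W_def)
      have c0: "0 \<le> c" using \<beta> by (simp add: c_def)
      have a: "c * \<bar>P (W 1)\<bar> \<le> 1 / s / (2 * \<beta>) / n"
        if "\<bar>P (W 1)\<bar> \<le> W 1 powr s / s" "0 < s" "1 \<le> r + 2 * s" for P :: "real \<Rightarrow> real" and s
      proof -
        have "c * \<bar>P (W 1)\<bar> \<le> c * (W 1 powr s / s)" using that c0 by (intro mult_left_mono)
        also have "\<dots> = n powr (- r + - 2 * s) / (2 * \<beta> * s)"
          unfolding powr_add W1 by (simp add: c_def powr_powr)
        also have "\<dots> \<le> n powr (- 1) / (2 * \<beta> * s)"
          using that n \<beta> by (intro divide_right_mono powr_mono) auto
        also have "\<dots> = 1 / s / (2 * \<beta>) / n" using n by (simp add: powr_minus_divide)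
        finally show ?thesis .
      qed
      have "cmod (F 1) \<le> c * \<bar>P\<^sub>1 (W 1)\<bar> + c * \<bar>P\<^sub>2 (W 1)\<bar>"
        unfolding F_def using c0
        by (intro order.trans[OF norm_triangle_ineq4]) (simp add: norm_mult abs_mult)
      also have "\<dots> \<le> 1 / s\<^sub>1 / (2 * \<beta>) / n + 1 / s\<^sub>2 / (2 * \<beta>) / n"
        using s r01 n W1 by (intro add_mono a P\<^sub>1(3) P\<^sub>2(3)) (auto simp: s\<^sub>1_def s\<^sub>2_def field_simps)
      finally show ?thesis by (simp add: add_divide_distrib)
    qed
    \<comment> \<open>The two limits \<open>1 / sin t\<close> and \<open>1 / cos t\<close> combine to \<open>2 exp (- \<i> t) / sin (2 t)\<close>.\<close>
    moreover have "L = of_real (pi / (\<beta> * sin (pi * r))) * exp (- \<i> * of_real (r * pi / 2)) * of_real (n powr (- r))"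
    proof -
      define t where "t = r * pi / 2"
      have t: "0 < t" "t < pi / 2" using r01 by (auto simp: t_def)
      have "sin (pi * s\<^sub>1) = sin t"
        using sin_pi_minus[of t] by (simp add: s\<^sub>1_def t_def algebra_simps)
      moreover have "sin (pi * s\<^sub>2) = cos t"
        unfolding cos_sin_eq by (simp add: s\<^sub>2_def t_def field_simps)
      moreover have "sin (pi * r) = 2 * sin t * cos t"
        using sin_double[of t] by (simp add: t_def mult.commute)
      moreover have "exp (- \<i> * of_real t) = of_real (cos t) - \<i> * of_real (sin t)"
        using cis_conv_exp[of "- t"] by (simp add: complex_eq_iff)
      moreover have "sin t \<noteq> 0" "cos t \<noteq> 0" using t sin_gt_zero[of t] cos_gt_zero[of t] by auto
      ultimately show ?thesis
        unfolding t_def[symmetric] L_def c_def using \<beta> by (simp add: complex_eq_iff field_simps)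
    qed
    ultimately show "cmod (kernel_transform \<alpha> \<beta> ?y - of_real (pi / (\<beta> * sin (pi * r))) *
        exp (- \<i> * of_real (r * pi / 2)) * of_real (n powr (- r))) \<le> C / n"
      using norm_triangle_ineq4[of "kernel_transform \<alpha> \<beta> ?y - (L - F 1)" "F 1"]
      by (simp add: C_def add_divide_distrib)
  qed
qed

lemma cmod_Ln_one_plus_imaginary_le:
  fixes n :: real
  assumes n: "1 \<le> n"
  shows "cmod (Ln (1 + \<i> * of_real n) - of_real (ln n)) \<le> ln 2 + pi"
proof -
  let ?w = "1 + \<i> * complex_of_real n"
  have w: "?w \<noteq> 0" by (simp add: complex_eq_iff)
  have lower: "n \<le> cmod ?w" using abs_Im_le_cmod[of ?w] by simp
  have "cmod ?w \<le> 1 + n" using norm_triangle_ineq[of 1 "\<i> * complex_of_real n"] n by (simp add: norm_mult)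
  hence upper: "cmod ?w \<le> 2 * n" using n by simp
  have "ln (cmod ?w) \<le> ln (2 * n)" using upper lower n
    by (intro iffD2[OF ln_le_cancel_iff]) linarith+
  hence "\<bar>Re (Ln ?w) - ln n\<bar> \<le> ln 2"
    using lower n w by (simp add: Re_Ln ln_mult)
  moreover have "\<bar>Im (Ln ?w)\<bar> \<le> pi"
    using mpi_less_Im_Ln[OF w] Im_Ln_le_pi[OF w] by simp
  ultimately show ?thesis
    using cmod_le[of "Ln ?w - of_real (ln n)"] by simp
qed

text \<open>For \<open>\<alpha> = 1\<close> the summand \<open>1 / (x (y + x\<^sup>\<beta>))\<close>, where \<open>y = \<i> n\<close>, has the primitive
  \<open>- Ln (1 + y x\<^sup>-\<^sup>\<beta>) / (\<beta> y)\<close>. Its argument has real part 1, so the principal logarithm is smooth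
  along the whole path, and it vanishes at infinity.\<close>

lemma kernel_transform_axis_asymp_log:
  fixes \<beta> :: real
  assumes \<beta>: "0 < \<beta>"
  obtains C where "0 \<le> C" and
    "\<And>n::real. 1 \<le> n \<Longrightarrow>
      cmod (kernel_transform 1 \<beta> (\<i> * of_real n) - of_real (ln n) / (\<i> * of_real n * of_real \<beta>)) \<le> C / n"
proof -
  define C where "C = (1 + \<beta>) * (\<Sum>j. real (Suc j) powr (- 1 - 1)) + (ln 2 + pi) / \<beta>"
  have "0 \<le> (\<Sum>j. real (Suc j) powr (- 1 - 1))"
    by (intro suminf_nonneg summable_Suc_powr) auto
  hence C0: "0 \<le> C" unfolding C_def using \<beta> by (auto intro!: add_nonneg_nonneg divide_nonneg_pos)
  show ?thesis
  proof (rule that[OF C0])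
    fix n :: real assume n: "1 \<le> n"
    let ?y = "\<i> * complex_of_real n"
    define W where "W x = 1 + ?y * of_real (x powr (- \<beta>))" for x :: real
    define F where "F x = - (1 / (?y * of_real \<beta>)) * Ln (W x)" for x
    have y0: "?y \<noteq> 0" using n by simp
    have dF: "(F has_vector_derivative 1 / (of_real (x powr 1) * (?y + of_real (x powr \<beta>)))) (at x)"
      if x: "1 \<le> x" for x
    proof -
      have "(W has_vector_derivative ?y * of_real (- \<beta> * x powr (- \<beta> - 1))) (at x)"
        unfolding W_def[abs_def] using x by (auto intro!: derivative_eq_intros)
      moreover have "W x \<notin> \<real>\<^sub>\<le>\<^sub>0" by (simp add: W_def complex_nonpos_Reals_iff)
      hence "(Ln has_field_derivative inverse (W x)) (at (W x))" by (rule has_field_derivative_Ln)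
      ultimately have "((\<lambda>x. Ln (W x)) has_vector_derivative
          ?y * of_real (- \<beta> * x powr (- \<beta> - 1)) * inverse (W x)) (at x)"
        using field_vector_diff_chain_at unfolding o_def by blast
      hence "(F has_vector_derivative
          - (1 / (?y * of_real \<beta>)) * (?y * of_real (- \<beta> * x powr (- \<beta> - 1)) * inverse (W x))) (at x)"
        unfolding F_def[abs_def] by (rule has_vector_derivative_mult_right)
      also have "- (1 / (?y * of_real \<beta>)) * (?y * of_real (- \<beta> * x powr (- \<beta> - 1)) * inverse (W x))
          = of_real (x powr (- \<beta> - 1)) * inverse (W x)"
        using y0 \<beta> by simp
      also have "\<dots> = 1 / (of_real (x powr 1) * (?y + of_real (x powr \<beta>)))"
      proof -
        have "x powr (- \<beta> - 1) = 1 / (x powr \<beta> * x)"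
          using x by (simp add: powr_diff powr_minus_divide)
        moreover have "W x = (?y + of_real (x powr \<beta>)) / of_real (x powr \<beta>)"
          using x by (simp add: W_def powr_minus_divide field_simps)
        ultimately show ?thesis using x by simp
      qed
      finally show ?thesis .
    qed
    have "((\<lambda>x. x powr (- \<beta>)) \<longlongrightarrow> 0) at_top"
      using \<beta> by (intro tendsto_neg_powr filterlim_ident) auto
    hence "(W \<longlongrightarrow> 1 + ?y * of_real 0) at_top"
      unfolding W_def[abs_def] by (intro tendsto_intros)
    hence "((\<lambda>x. Ln (W x)) \<longlongrightarrow> Ln (1 + ?y * of_real 0)) at_top"
      by (intro tendsto_Ln) auto
    hence "(F \<longlongrightarrow> - (1 / (?y * of_real \<beta>)) * Ln (1 + ?y * of_real 0)) at_top"
      unfolding F_def[abs_def] by (intro tendsto_mult_left)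
    hence limF: "(F \<longlongrightarrow> 0) at_top" by simp
    have "cmod (kernel_transform 1 \<beta> ?y - (0 - F 1))
        \<le> (1 + \<beta>) * (\<Sum>j. real (Suc j) powr (- 1 - 1)) / n"
      using \<beta> n dF limF by (intro kernel_transform_axis_primitive) auto
    moreover have "- F 1 - of_real (ln n) / (?y * of_real \<beta>)
        = (Ln (1 + ?y) - of_real (ln n)) / (?y * of_real \<beta>)"
      by (simp add: F_def W_def diff_divide_distrib)
    hence "cmod (- F 1 - of_real (ln n) / (?y * of_real \<beta>))
        = cmod (Ln (1 + ?y) - of_real (ln n)) / (n * \<beta>)"
      using n \<beta> by (simp add: norm_divide norm_mult)
    hence "cmod (- F 1 - of_real (ln n) / (?y * of_real \<beta>)) \<le> (ln 2 + pi) / (n * \<beta>)"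
      using cmod_Ln_one_plus_imaginary_le[OF n] n \<beta> by (simp add: divide_right_mono)
    ultimately show "cmod (kernel_transform 1 \<beta> ?y - of_real (ln n) / (?y * of_real \<beta>)) \<le> C / n"
      using norm_triangle_ineq[of "kernel_transform 1 \<beta> ?y - (0 - F 1)" "- F 1 - of_real (ln n) / (?y * of_real \<beta>)"]
      by (simp add: C_def add_divide_distrib mult.commute)
  qed
qed

section \<open>Expansion of the zeros\<close>

text \<open>This collects the zeros into a sequence and replaces \<open>K(\<i> n)\<close> by an approximation \<open>m n\<close>. With
  \<open>\<kappa> = O(n\<^sup>-\<^sup>q)\<close> the quadratic error \<open>n \<kappa>\<^sup>2\<close> is \<open>O(n\<^sup>1\<^sup>-\<^sup>2\<^sup>q)\<close>. The exponent \<open>q\<close> is kept apart from \<open>r\<close> so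
  that the logarithmic case is covered too, with \<open>q = 1/2\<close>.\<close>

lemma spectral_zero_sequence:
  fixes m :: "nat \<Rightarrow> complex"
  assumes \<beta>: "0 < \<beta>" and \<alpha>\<beta>: "\<alpha> + \<beta> > 1" and q: "0 < q" and C: "0 \<le> C"
    and m: "\<And>n. 1 \<le> n \<Longrightarrow> cmod (kernel_transform \<alpha> \<beta> (\<i> * of_nat n) - m n) \<le> C / n"
    and \<kappa>: "\<And>n. 1 \<le> n \<Longrightarrow> cmod (kernel_transform \<alpha> \<beta> (\<i> * of_nat n)) \<le> A * n powr (- q)"
  shows "\<exists>z D.
    (\<forall>n\<ge>1. z n \<in> spectral_zeros \<alpha> \<beta> n \<and> cnj (z n) \<in> spectral_zeros \<alpha> \<beta> n) \<and>
    (\<forall>\<^sub>F n in sequentially. z n \<noteq> cnj (z n)) \<and>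
    (\<forall>\<^sub>F n in sequentially.
      cmod (z n - (\<i> * of_nat n - \<i> * of_nat n * m n / 2)) \<le> D * (1 + n powr (1 - 2 * q)))"
proof -
  let ?y = "\<lambda>n. \<i> * complex_of_nat n"
  define K where "K n = kernel_transform \<alpha> \<beta> (?y n)" for n
  \<comment> \<open>The fixed point when \<open>K(\<i> n)\<close> is small, and otherwise the real zero.\<close>
  have ex: "\<exists>z. z \<in> spectral_zeros \<alpha> \<beta> n \<and> cnj z \<in> spectral_zeros \<alpha> \<beta> n \<and> (cmod (K n) \<le> 1 / 6 \<longrightarrow>
      cmod (z - ?y n) \<le> n / 2 \<and> cmod (z - (?y n - ?y n * K n / 2)) \<le> 11 * n * (cmod (K n))\<^sup>2)"
    if n: "1 \<le> n" for n
  proof (cases "cmod (K n) \<le> 1 / 6")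
    case True
    then obtain z where z: "z \<in> spectral_zeros \<alpha> \<beta> n" "cmod (z - ?y n) \<le> n / 2"
        "cmod (z - (?y n - ?y n * K n / 2)) \<le> 11 * n * (cmod (K n))\<^sup>2"
      using spectral_zero_near_axis[OF \<alpha>\<beta> n True[unfolded K_def]] unfolding K_def by metis
    have "summable (kernel_term \<alpha> \<beta> z)"
      using summable_kernel_term_near_axis[OF \<alpha>\<beta>, of "real n" z] z n by simp
    from cnj_mem_spectral_zeros[OF z(1) this] z show ?thesis by (intro exI[of _ z]) simp
  next
    case False
    with real_spectral_zero_exists[OF \<beta> \<alpha>\<beta> n] show ?thesis by (metis complex_cnj_complex_of_real)
  qed
  then obtain z where z: "\<And>n. 1 \<le> n \<Longrightarrow> z n \<in> spectral_zeros \<alpha> \<beta> n \<and> cnj (z n) \<in> spectral_zeros \<alpha> \<beta> n \<and>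
      (cmod (K n) \<le> 1 / 6 \<longrightarrow> cmod (z n - ?y n) \<le> n / 2 \<and>
        cmod (z n - (?y n - ?y n * K n / 2)) \<le> 11 * n * (cmod (K n))\<^sup>2)"
    by metis
  have "(\<lambda>n. A * real n powr (- q)) \<longlonglongrightarrow> A * 0"
    using q by (intro tendsto_mult_left tendsto_neg_powr filterlim_real_sequentially) auto
  hence "\<forall>\<^sub>F n in sequentially. A * real n powr (- q) < 1 / 6"
    by (rule order_tendstoD) simp
  hence small: "\<forall>\<^sub>F n in sequentially. 1 \<le> n \<and> cmod (K n) \<le> 1 / 6"
    using eventually_ge_at_top[of 1]
  proof eventually_elim
    case (elim n)
    thus ?case using \<kappa>[of n] by (simp add: K_def)
  qed
  define D where "D = 11 * A\<^sup>2 + C"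
  show ?thesis
  proof (intro exI[of _ z] exI[of _ D] conjI)
    show "\<forall>n\<ge>1. z n \<in> spectral_zeros \<alpha> \<beta> n \<and> cnj (z n) \<in> spectral_zeros \<alpha> \<beta> n"
      using z by blast
    show "\<forall>\<^sub>F n in sequentially. z n \<noteq> cnj (z n)"
      using small
    proof eventually_elim
      case (elim n)
      have "\<bar>Im (z n) - n\<bar> \<le> n / 2"
        using z[of n] elim abs_Im_le_cmod[of "z n - ?y n"] by auto
      moreover have "0 < real n" using elim by simp
      ultimately have "Im (z n) > 0" by linarith
      thus ?case by (simp add: complex_eq_iff)
    qed
    show "\<forall>\<^sub>F n in sequentially.
        cmod (z n - (?y n - ?y n * m n / 2)) \<le> D * (1 + n powr (1 - 2 * q))"
      using small
    proof eventually_elim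
      case (elim n)
      have n: "0 < real n" using elim by simp
      have "z n - (?y n - ?y n * m n / 2) = (z n - (?y n - ?y n * K n / 2)) - ?y n * (K n - m n) / 2"
        by (simp add: right_diff_distrib diff_divide_distrib)
      hence "cmod (z n - (?y n - ?y n * m n / 2))
          \<le> cmod (z n - (?y n - ?y n * K n / 2)) + cmod (?y n * (K n - m n) / 2)"
        by (simp only: norm_triangle_ineq4)
      also have "cmod (?y n * (K n - m n) / 2) = n * cmod (K n - m n) / 2"
        by (simp add: norm_mult norm_divide)
      also have "\<dots> \<le> n * (C / n) / 2"
        using m[of n] elim by (intro divide_right_mono mult_left_mono) (auto simp: K_def)
      also have "\<dots> \<le> C" using n C by simp
      also have "cmod (z n - (?y n - ?y n * K n / 2)) \<le> 11 * n * (cmod (K n))\<^sup>2"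
        using z[of n] elim by simp
      also have "\<dots> \<le> 11 * n * (A * n powr (- q))\<^sup>2"
        using \<kappa>[of n] elim by (intro mult_left_mono power_mono) (auto simp: K_def)
      also have "\<dots> = 11 * A\<^sup>2 * n powr (1 - 2 * q)"
      proof -
        have "real n * (n powr (- q))\<^sup>2 = n powr 1 * (n powr (- q) * n powr (- q))"
          using n by (simp add: power2_eq_square)
        also have "\<dots> = n powr (1 - 2 * q)" unfolding powr_add[symmetric] by simp
        finally show ?thesis by (simp add: power_mult_distrib mult_ac)
      qed
      also have "11 * A\<^sup>2 * n powr (1 - 2 * q) + C \<le> D * (1 + n powr (1 - 2 * q))"
        using C by (simp add: D_def algebra_simps)
      finally show ?case by simp
    qed
  qed
qed

lemma ln_le_two_sqrt:
  fixes x :: real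
  assumes "0 < x"
  shows "ln x \<le> 2 * x powr (1 / 2)"
  using ln_bound[of "x powr (1 / 2)"] assms by (simp add: ln_powr)

theorem theorem1:
  fixes \<alpha> \<beta> r :: real
  assumes "0 < \<alpha>" and "\<alpha> \<le> 1" and "\<alpha> + \<beta> > 1"
    and "r = (\<alpha> + \<beta> - 1) / \<beta>"
  shows "0 < r \<and> r \<le> 1 \<and>
    (\<exists>zp zm :: nat \<Rightarrow> complex.
       (\<forall>n\<ge>1. zp n \<in> spectral_zeros \<alpha> \<beta> n \<and> zm n \<in> spectral_zeros \<alpha> \<beta> n \<and> zm n = cnj (zp n)) \<and>
       (\<forall>\<^sub>F n in sequentially. zp n \<noteq> zm n) \<and>
       (r < 1 \<longrightarrow>
         (\<exists>e1 e2 :: nat \<Rightarrow> complex.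
            e1 \<in> O(\<lambda>n. 1) \<and>
            e2 \<in> O(\<lambda>n. complex_of_real (real n powr (1 - 2 * r))) \<and>
            (\<forall>n\<ge>1. zp n = \<i> * of_nat n
               + of_real (spectral_coeff \<beta> r) * exp (- \<i> * of_real ((r + 1) * pi / 2))
                   * of_real (real n powr (1 - r))
               + e1 n + e2 n))) \<and>
       (r = 1 \<longrightarrow>
         (\<lambda>n. zp n - (\<i> * of_nat n - of_real (ln (real n) / (2 * \<beta>)))) \<in> O(\<lambda>n. 1) \<and>
         (\<lambda>n. zm n - (- \<i> * of_nat n - of_real (ln (real n) / (2 * \<beta>)))) \<in> O(\<lambda>n. 1)))"
proof -
  have \<beta>: "0 < \<beta>" using assms by simp
  have r0: "0 < r" and r1: "r \<le> 1" unfolding assms(4) using assms(1-3) \<beta> by (auto simp: divide_le_eq)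
  show ?thesis
  proof (cases "r < 1")
    case True
    have \<alpha>: "\<alpha> < 1" using True assms(4) \<beta> by (simp add: field_simps)
    define M where "M = of_real (pi / (\<beta> * sin (pi * r))) * exp (- \<i> * of_real (r * pi / 2))"
    obtain C where C: "0 \<le> C" and asymp: "\<And>n::real. 1 \<le> n \<Longrightarrow>
        cmod (kernel_transform \<alpha> \<beta> (\<i> * of_real n) - M * of_real (n powr (- r))) \<le> C / n"
      using kernel_transform_axis_asymp_power[OF assms(1) \<alpha> assms(3,4)] unfolding M_def by metis
    have asymp_nat: "cmod (kernel_transform \<alpha> \<beta> (\<i> * of_nat n) - M * of_real (n powr (- r))) \<le> C / n"
      if "1 \<le> n" for n :: nat
      using asymp[of "real n"] that by simp
    have upper: "cmod (kernel_transform \<alpha> \<beta> (\<i> * of_nat n)) \<le> (C + cmod M) * n powr (- r)"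
      if n: "1 \<le> n" for n :: nat
    proof -
      have "cmod (kernel_transform \<alpha> \<beta> (\<i> * of_nat n)) \<le> C / n + cmod (M * of_real (n powr (- r)))"
        using asymp_nat[OF n] norm_triangle_sub[of "kernel_transform \<alpha> \<beta> (\<i> * of_nat n)" "M * of_real (n powr (- r))"]
        by simp
      also have "C / n = C * n powr (- 1)" using n by (simp add: powr_minus_divide)
      also have "\<dots> \<le> C * n powr (- r)"
        using C r1 n by (intro mult_left_mono powr_mono) auto
      finally show ?thesis by (simp add: norm_mult algebra_simps)
    qed
    obtain z D where
      z: "\<forall>n\<ge>1. z n \<in> spectral_zeros \<alpha> \<beta> n \<and> cnj (z n) \<in> spectral_zeros \<alpha> \<beta> n"
      "\<forall>\<^sub>F n in sequentially. z n \<noteq> cnj (z n)"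
      and D: "\<forall>\<^sub>F n in sequentially. cmod (z n - (\<i> * of_nat n - \<i> * of_nat n * (M * of_real (n powr (- r))) / 2))
          \<le> D * (1 + n powr (1 - 2 * r))"
      using spectral_zero_sequence[where m = "\<lambda>n. M * of_real (real n powr (- r))",
          OF \<beta> assms(3) r0 C asymp_nat upper] by auto
    define R where "R n = z n - (\<i> * of_nat n
        + of_real (spectral_coeff \<beta> r) * exp (- \<i> * of_real ((r + 1) * pi / 2)) * of_real (real n powr (1 - r)))"
      for n
    \<comment> \<open>Multiplication by \<open>- \<i>\<close> turns the phase \<open>- r \<pi> / 2\<close> into \<open>- (r + 1) \<pi> / 2\<close>, and the factor
      \<open>1/2\<close> of the square root is the one in \<open>spectral_coeff\<close>.\<close>
    have lead: "\<i> * of_nat n - \<i> * of_nat n * (M * of_real (n powr (- r))) / 2 = \<i> * of_nat n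
        + of_real (spectral_coeff \<beta> r) * exp (- \<i> * of_real ((r + 1) * pi / 2)) * of_real (real n powr (1 - r))"
      if n: "1 \<le> n" for n :: nat
    proof -
      have "exp (- \<i> * of_real ((r + 1) * pi / 2)) = cis (- (r * pi / 2) + - (pi / 2))"
        unfolding cis_conv_exp by (simp add: field_simps)
      also have "\<dots> = exp (- \<i> * of_real (r * pi / 2)) * (- \<i>)"
        unfolding cis_mult[symmetric] cis_conv_exp[of "- (r * pi / 2)"] by simp
      finally have "exp (- \<i> * of_real ((r + 1) * pi / 2)) = exp (- \<i> * of_real (r * pi / 2)) * (- \<i>)" .
      moreover have "real n powr (1 - r) = n * n powr (- r)"
        using n by (simp add: powr_diff powr_minus divide_inverse)
      moreover have "pi / (\<beta> * sin (pi * r)) = 2 * spectral_coeff \<beta> r"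
        by (simp add: spectral_coeff_def)
      ultimately show ?thesis unfolding M_def by simp
    qed
    have R: "\<forall>\<^sub>F n in sequentially. cmod (R n) \<le> D * (1 + n powr (1 - 2 * r))"
      using D eventually_ge_at_top[of 1]
      by eventually_elim (simp only: R_def lead)
    have D0: "D * (1 + n powr (1 - 2 * r)) \<le> \<bar>D\<bar> * (1 + n powr (1 - 2 * r))" for n :: nat
      by (intro mult_right_mono add_nonneg_nonneg) auto
    \<comment> \<open>Of the two error terms only the larger one is used: \<open>O(1)\<close> if \<open>r \<ge> 1/2\<close>, otherwise
      \<open>O(n\<^sup>1\<^sup>-\<^sup>2\<^sup>r)\<close>.\<close>
    define e1 where "e1 n = (if 1 / 2 \<le> r then R n else 0)" for n
    define e2 where "e2 n = (if 1 / 2 \<le> r then 0 else R n)" for n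
    have "e1 \<in> O(\<lambda>n. 1)"
    proof (cases "1 / 2 \<le> r")
      case True
      have "\<forall>\<^sub>F n in sequentially. cmod (e1 n) \<le> (2 * \<bar>D\<bar>) * cmod 1"
        using R eventually_ge_at_top[of 1]
      proof eventually_elim
        case (elim n)
        have "real n powr (1 - 2 * r) \<le> n powr 0" using True elim by (intro powr_mono) auto
        hence "\<bar>D\<bar> * (1 + n powr (1 - 2 * r)) \<le> \<bar>D\<bar> * 2" using elim by (intro mult_left_mono) auto
        thus ?case using elim(1) D0[of n] True by (simp add: e1_def)
      qed
      thus ?thesis by (rule bigoI)
    next
      case False
      thus ?thesis by (simp add: e1_def[abs_def])
    qed
    moreover have "e2 \<in> O(\<lambda>n. complex_of_real (real n powr (1 - 2 * r)))"
    proof (cases "1 / 2 \<le> r")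
      case True
      thus ?thesis by (simp add: e2_def[abs_def])
    next
      case False
      have "\<forall>\<^sub>F n in sequentially. cmod (e2 n) \<le> (2 * \<bar>D\<bar>) * cmod (complex_of_real (real n powr (1 - 2 * r)))"
        using R eventually_ge_at_top[of 1]
      proof eventually_elim
        case (elim n)
        have "1 \<le> real n powr (1 - 2 * r)" using False elim by (intro ge_one_powr_ge_zero) auto
        hence "\<bar>D\<bar> * (1 + n powr (1 - 2 * r)) \<le> \<bar>D\<bar> * (2 * n powr (1 - 2 * r))"
          by (intro mult_left_mono) auto
        thus ?case using elim(1) D0[of n] False by (simp add: e2_def)
      qed
      thus ?thesis by (rule bigoI)
    qed
    moreover have "z n = \<i> * of_nat n
        + of_real (spectral_coeff \<beta> r) * exp (- \<i> * of_real ((r + 1) * pi / 2)) * of_real (real n powr (1 - r))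
        + e1 n + e2 n" for n
      by (simp add: e1_def e2_def R_def)
    ultimately show ?thesis
      using z r0 r1 True by (intro conjI exI[of _ z] exI[of _ "\<lambda>n. cnj (z n)"]) blast+
  next
    case False
    hence req: "r = 1" using r1 by simp
    hence \<alpha>: "\<alpha> = 1" using assms(4) \<beta> by (simp add: field_simps)
    define m where "m n = of_real (ln n) / (\<i> * of_real n * of_real \<beta>)" for n :: real
    obtain C where C: "0 \<le> C"
      and asymp: "\<And>n::real. 1 \<le> n \<Longrightarrow> cmod (kernel_transform \<alpha> \<beta> (\<i> * of_real n) - m n) \<le> C / n"
      using kernel_transform_axis_asymp_log[OF \<beta>] unfolding m_def \<alpha> by metis
    have asymp_nat: "cmod (kernel_transform \<alpha> \<beta> (\<i> * of_nat n) - m (real n)) \<le> C / n"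
      if "1 \<le> n" for n :: nat
      using asymp[of "real n"] that by simp
    \<comment> \<open>\<open>K(\<i> n)\<close> has size \<open>ln n / n\<close>; the exponent \<open>1/2\<close> already makes its square \<open>O(1 / n)\<close>.\<close>
    have upper: "cmod (kernel_transform \<alpha> \<beta> (\<i> * of_nat n)) \<le> (C + 2 / \<beta>) * n powr (- (1 / 2))"
      if n: "1 \<le> n" for n :: nat
    proof -
      have "cmod (m n) = ln n / (n * \<beta>)"
        using n \<beta> by (simp add: m_def norm_divide norm_mult)
      also have "\<dots> \<le> 2 * n powr (1 / 2) / (n * \<beta>)"
        using n \<beta> ln_le_two_sqrt[of "real n"] by (intro divide_right_mono) auto
      also have "\<dots> = 2 / \<beta> * (n powr (1 / 2) * n powr (- 1))"
        using n by (simp add: powr_minus_divide)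
      also have "n powr (1 / 2) * n powr (- 1) = n powr (- (1 / 2))"
        unfolding powr_add[symmetric] by simp
      finally have "cmod (m n) \<le> 2 / \<beta> * n powr (- (1 / 2))" .
      moreover have "C / n = C * n powr (- 1)" using n by (simp add: powr_minus_divide)
      moreover have "C * n powr (- 1) \<le> C * n powr (- (1 / 2))"
        using C n by (intro mult_left_mono powr_mono) auto
      ultimately show ?thesis
        using asymp_nat[OF n] norm_triangle_sub[of "kernel_transform \<alpha> \<beta> (\<i> * of_nat n)" "m n"]
        by (simp add: distrib_right)
    qed
    obtain z D where
      z: "\<forall>n\<ge>1. z n \<in> spectral_zeros \<alpha> \<beta> n \<and> cnj (z n) \<in> spectral_zeros \<alpha> \<beta> n"
      "\<forall>\<^sub>F n in sequentially. z n \<noteq> cnj (z n)"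
      and D: "\<forall>\<^sub>F n in sequentially. cmod (z n - (\<i> * of_nat n - \<i> * of_nat n * m n / 2))
          \<le> D * (1 + n powr (1 - 2 * (1 / 2)))"
      using spectral_zero_sequence[where m = "\<lambda>n. m (real n)" and q = "1 / 2",
          OF \<beta> assms(3) _ C asymp_nat upper] by auto
    have ev: "\<forall>\<^sub>F n in sequentially. cmod (z n - (\<i> * of_nat n - of_real (ln (real n) / (2 * \<beta>)))) \<le> D * 2 * cmod 1"
      using D eventually_ge_at_top[of 1]
    proof eventually_elim
      case (elim n)
      have "\<i> * of_nat n * m n / 2 = of_real (ln (real n) / (2 * \<beta>))"
        using elim \<beta> by (simp add: m_def)
      thus ?case using elim by (simp add: mult.commute)
    qed
    hence up: "(\<lambda>n. z n - (\<i> * of_nat n - of_real (ln (real n) / (2 * \<beta>)))) \<in> O(\<lambda>n. 1)"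
      by (rule bigoI)
    have down: "(\<lambda>n. cnj (z n) - (- \<i> * of_nat n - of_real (ln (real n) / (2 * \<beta>)))) \<in> O(\<lambda>n. 1)"
    proof (rule bigoI)
      have "cmod (cnj (z n) - (- \<i> * of_nat n - of_real (ln (real n) / (2 * \<beta>))))
          = cmod (cnj (z n - (\<i> * of_nat n - of_real (ln (real n) / (2 * \<beta>)))))" for n
        by simp
      thus "\<forall>\<^sub>F n in sequentially. cmod (cnj (z n) - (- \<i> * of_nat n - of_real (ln (real n) / (2 * \<beta>))))
          \<le> D * 2 * cmod 1"
        using ev by (simp only: complex_mod_cnj)
    qed
    have pair: "\<forall>n\<ge>1. z n \<in> spectral_zeros \<alpha> \<beta> n \<and> cnj (z n) \<in> spectral_zeros \<alpha> \<beta> n \<and> cnj (z n) = cnj (z n)"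
      using z(1) by blast
    show ?thesis
      by (intro conjI exI[of _ z] exI[of _ "\<lambda>n. cnj (z n)"] impI)
        (rule r0 r1 pair z(2) up down | erule notE[OF False])+
  qed
qed

end
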